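(* Let $d\in\mathbb{N}$, let $c>0$ be a fixed constant, and let $0<\epsilon_0\le 1/d$. Let $\sigma:\mathbb{R}^d\to\mathbb{R}$ be a twice-differentiable function satisfying $\int_{\mathbb{R}^d}\sigma(x)\,dx=1$ and, for every $x\in\mathbb{R}^d$, $\sigma(-x)=\sigma(x)$ and $$\|\nabla_x^j\sigma(x)\|\le \frac{C'}{\left(c^{-1}+\|x\|^d\right)^{1+\epsilon_0+j/d}},\qquad j=0,1,2,$$ with some constant $C'>0$. Let $\psi_{k,b}$ and $\mathcal{L}_1$ be associated with $\sigma$ as in the context. Let $\sigma_0\in L^2(\mathbb{R}^d)$ be arbitrary. For $\epsilon>0$, assume that $$\operatorname{dist}(\sigma,\sigma^\dagger)<\epsilon,\qquad\text{where }\ \sigma^\dagger(x):=\sum_{m=1}^{M}c_m\,\sigma_0(x-b_m),$$ with some fixed $M=M(\epsilon)\in\mathbb{N}$, $b_m\in\mathbb{R}^d$ and $c_m\in\mathbb{R}$. Let $f\in\mathcal{L}_1$, $N\in\mathbb{N}$, and let $$f_N=\sum_{(k,b)\in\Lambda}\chi_N(k,b)\,c_{k,b}\,\psi_{k,b},$$ where $c_{k,b}\in\mathbb{R}$ and $\chi_N(k,b)$ equals $1$ for at most $N$ indices $(k,b)\in\Lambda$ and is $0$ otherwise, be such that $\|f-f_N\|_{L^2}\le\|f\|_{\mathcal{L}_1}(N+1)^{-1/2}$. Then there exist $\alpha_n\in\mathbb{R}$, $\gamma_n\in\mathbb{R}$ and $\vec\theta_n\in\mathbb{R}^d$, $n=1,\dots,2N\cdot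 M$, such that the function $$\Psi_N(\vec x)=\sum_{n=1}^{2N\cdot M}\alpha_n\,\sigma_0(\gamma_n\vec x+\vec\theta_n),\qquad\vec x\in\mathbb{R}^d,$$ satisfies $$\|f-\Psi_N\|_{L^2}\le\|f\|_{\mathcal{L}_1}(N+1)^{-1/2}+\epsilon\sum_{(k,b)\in\Lambda}\chi_N(k,b)\,|c_{k,b}|.$$
   Context: $\|x\|$ is the Euclidean norm on $\mathbb{R}^d$; $\nabla^0\sigma=\sigma$, $\nabla^1\sigma$ is the gradient and $\nabla^2\sigma$ the Hessian; $L^2=L^2(\mathbb{R}^d)$ with Lebesgue measure. For $k\in\mathbb{Z}$ and $x,b\in\mathbb{R}^d$ put $$S_k(x,b)=2^k\sigma(2^{k/d}(x-b)),\qquad \psi_{k,b}(x)=2^{-k/2}\left(S_k(x,b)-S_{k-1}(x,b)\right).$$ Let $\Lambda=\{(k,b)\in\mathbb{Z}\times\mathbb{R}^d: b\in 2^{-k/d}\mathbb{Z}^d\}$. For $f\in L^2(\mathbb{R}^d)$ define $$\|f\|_{\mathcal{L}_1}=\inf\Big\{\sum_{(k,b)\in\Lambda}|c_{k,b}| : f=\sum_{(k,b)\in\Lambda}c_{k,b}\psi_{k,b}\Big\}$$ (expansions in $L^2$; infimum of the empty set is $\infty$), and $\mathcal{L}_1=\{f\in L^2(\mathbb{R}^d):\|f\|_{\mathcal{L}_1}<\infty\}$. For $\sigma_1,\sigma_2\in L^2(\mathbb{R}^d)$, $\operatorname{dist}(\sigma_1,\sigma_2)=\left(1+\frac{1}{\sqrt2}\right)\|\sigma_1-\sigma_2\|_{L^2}$.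 *)

theory Defs
  imports "HOL-Analysis.Analysis"
begin

definition gradient :: "(real^'n \<Rightarrow> real) \<Rightarrow> real^'n \<Rightarrow> real^'n" where
  "gradient f x = (\<chi> i. frechet_derivative f (at x) (axis i 1))"

(* norm (hessian f x) is the Euclidean (Frobenius) norm of the matrix; any other matrix norm
   differs from it by at most a factor depending only on the dimension. *)
definition hessian :: "(real^'n \<Rightarrow> real) \<Rightarrow> real^'n \<Rightarrow> real^'n^'n" where
  "hessian f x = jacobian (gradient f) (at x)"

definition twice_differentiable :: "(real^'n \<Rightarrow> real) \<Rightarrow> bool" where
  "twice_differentiable f \<longleftrightarrow>
     (\<forall>x. f differentiable (at x)) \<and> (\<forall>x. gradient f differentiable (at x))"

(* Elements of L2 are functions, not classes modulo null sets; all notions below depend only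
   on the class of f. *)
definition L2 :: "(real^'n \<Rightarrow> real) set" where
  "L2 = {f. f \<in> borel_measurable lebesgue \<and> integrable lebesgue (\<lambda>x. (f x)\<^sup>2)}"

(* Infinite outside L2: the Bochner integral of a non-integrable function is 0, so a real-valued
   norm would be 0 there. *)
definition L2_norm :: "(real^'n \<Rightarrow> real) \<Rightarrow> ennreal" where
  "L2_norm f = (if f \<in> L2 then ennreal (sqrt (\<integral>x. (f x)\<^sup>2 \<partial>lebesgue)) else \<infinity>)"

definition L2_dist :: "(real^'n \<Rightarrow> real) \<Rightarrow> (real^'n \<Rightarrow> real) \<Rightarrow> ennreal" where
  "L2_dist s1 s2 = ennreal (1 + 1 / sqrt 2) * L2_norm (\<lambda>x. s1 x - s2 x)"

definition S :: "(real^'n \<Rightarrow> real) \<Rightarrow> int \<Rightarrow> real^'n \<Rightarrow> real^'n \<Rightarrow> real" where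
  "S \<sigma> k x b = 2 powr k * \<sigma> ((2 powr (k / CARD('n))) *\<^sub>R (x - b))"

definition \<psi> :: "(real^'n \<Rightarrow> real) \<Rightarrow> int \<Rightarrow> real^'n \<Rightarrow> real^'n \<Rightarrow> real" where
  "\<psi> \<sigma> k b x = 2 powr (- k / 2) * (S \<sigma> k x b - S \<sigma> (k - 1) x b)"

definition \<Lambda> :: "(int \<times> (real^'n)) set" where
  "\<Lambda> = {(k, b). \<exists>z. (\<forall>i. z $ i \<in> \<int>) \<and> b = (2 powr (- k / CARD('n))) *\<^sub>R z}"

(* Convergence in L2 of the net of finite partial sums.  Only absolutely summable coefficients
   matter for L1_norm; for those, and uniformly L2-bounded \<psi> \<sigma> k b, this agrees with
   convergence along any enumeration of the countable set \<Lambda>. *)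
definition L2_expansion ::
    "(real^'n \<Rightarrow> real) \<Rightarrow> (real^'n \<Rightarrow> real) \<Rightarrow> (int \<Rightarrow> real^'n \<Rightarrow> real) \<Rightarrow> bool" where
  "L2_expansion \<sigma> f c \<longleftrightarrow>
     ((\<lambda>F. L2_norm (\<lambda>x. f x - (\<Sum>(k, b)\<in>F. c k b * \<psi> \<sigma> k b x))) \<longlongrightarrow> 0)
       (finite_subsets_at_top \<Lambda>)"

(* The norm of the space of functions with absolutely summable expansions in the \<psi> \<sigma> k b,
   not the norm of Lebesgue's L1. *)
definition L1_norm :: "(real^'n \<Rightarrow> real) \<Rightarrow> (real^'n \<Rightarrow> real) \<Rightarrow> ennreal" where
  "L1_norm \<sigma> f = Inf {\<Sum>\<^sub>\<infinity>(k, b)\<in>\<Lambda>. ennreal \<bar>c k b\<bar> | c. L2_expansion \<sigma> f c}"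

definition L1 :: "(real^'n \<Rightarrow> real) \<Rightarrow> (real^'n \<Rightarrow> real) set" where
  "L1 \<sigma> = {f \<in> L2. L1_norm \<sigma> f < \<infinity>}"

end

theory Submission imports Defs begin

(* A function psi built from a profile is linear in the profile, and rescaling by an affine map of
   ratio 2^(k/d) multiplies the L2 norm by 2^(-k/2), so that psi has L2 norm at most
   (1 + 1/sqrt 2) times that of the profile.  Hence replacing sigma by its approximant in each
   of the at most N terms of fN moves fN by at most epsilon times the sum of the |c_{k,b}|, and
   the new function is a combination of at most N * 2 * M rescaled translates of sigma0. *)

section \<open>Seminorm inequalities for \<open>L2_norm\<close>\<close>

lemma L2I: "f \<in> borel_measurable lebesgue \<Longrightarrow> integrable lebesgue (\<lambda>x. (f x)\<^sup>2) \<Longrightarrow> f \<in> L2"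
  by (simp add: L2_def)

lemma L2D:
  assumes "f \<in> L2"
  shows "f \<in> borel_measurable lebesgue" "integrable lebesgue (\<lambda>x. (f x)\<^sup>2)"
  using assms by (simp_all add: L2_def)

(* Convexity of the square, with weights A / (A + B) and B / (A + B). *)
lemma square_add_le:
  fixes A B u v :: real
  assumes "A > 0" "B > 0"
  shows "(u + v)\<^sup>2 \<le> (A + B) * (u\<^sup>2 / A + v\<^sup>2 / B)"
proof -
  have "(A + B) * (u\<^sup>2 / A + v\<^sup>2 / B) - (u + v)\<^sup>2 = (B * u - A * v)\<^sup>2 / (A * B)"
    using assms by (simp add: field_simps power2_eq_square)
  also have "\<dots> \<ge> 0"
    using assms by simp
  finally show ?thesis by simp
qed

lemma L2_add:
  assumes "f \<in> L2" "g \<in> L2"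
  shows "(\<lambda>x. f x + g x) \<in> L2"
proof (rule L2I)
  note [measurable] = assms[THEN L2D(1)]
  show "(\<lambda>x. f x + g x) \<in> borel_measurable lebesgue" by measurable
  have "integrable lebesgue (\<lambda>x. 2 * ((f x)\<^sup>2 + (g x)\<^sup>2))"
    using assms by (intro integrable_mult_right Bochner_Integration.integrable_add L2D)
  then show "integrable lebesgue (\<lambda>x. (f x + g x)\<^sup>2)"
  proof (rule Bochner_Integration.integrable_bound)
    show "AE x in lebesgue. norm ((f x + g x)\<^sup>2) \<le> norm (2 * ((f x)\<^sup>2 + (g x)\<^sup>2))"
      using square_add_le[of 1 1] by simp
  qed measurable
qed

text \<open>Integrating \<open>square_add_le\<close> with constants A and B slightly above the two
  norms bounds the square of the left side by \<open>(A + B)^2\<close>. If one of the functions lies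
  outside \<open>L2\<close>, the right side is infinite.\<close>

lemma L2_norm_triangle:
  fixes f g :: "real^'n \<Rightarrow> real"
  shows "L2_norm (\<lambda>x. f x + g x) \<le> L2_norm f + L2_norm g"
proof (cases "f \<in> L2 \<and> g \<in> L2")
  case True
  then have f: "f \<in> L2" and g: "g \<in> L2" by auto
  define I where "I h = (\<integral>x. (h x)\<^sup>2 \<partial>lebesgue)" for h :: "real^'n \<Rightarrow> real"
  have I_nonneg: "I h \<ge> 0" for h by (simp add: I_def)
  have "sqrt (I (\<lambda>x. f x + g x)) \<le> (sqrt (I f) + sqrt (I g)) + e" if "e > 0" for e
  proof -
    \<comment> \<open>The slack \<open>e / 2\<close> keeps both weights positive even when a norm
      vanishes, since \<open>square_add_le\<close> divides by them. The total excess is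
      \<open>e\<close>, which is arbitrary.\<close>
    define A B where "A = sqrt (I f) + e / 2" and "B = sqrt (I g) + e / 2"
    have A: "A > 0" and B: "B > 0"
      using that I_nonneg by (simp_all add: A_def B_def add_nonneg_pos)
    have IA: "I f \<le> A\<^sup>2" and IB: "I g \<le> B\<^sup>2"
      using that I_nonneg by (auto simp: A_def B_def intro!: sqrt_le_D)
    have "I (\<lambda>x. f x + g x) \<le> (\<integral>x. (A + B) * ((f x)\<^sup>2 / A + (g x)\<^sup>2 / B) \<partial>lebesgue)"
      unfolding I_def using f g A B
      by (intro integral_mono square_add_le L2D(2) L2_add integrable_mult_right Bochner_Integration.integrable_add
          integrable_divide) auto
    also have "\<dots> = (A + B) * (I f / A + I g / B)"
      using f g by (simp add: I_def L2D)
    also have "\<dots> \<le> (A + B) * (A\<^sup>2 / A + B\<^sup>2 / B)"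
      using A B IA IB by (intro mult_left_mono add_mono divide_right_mono) auto
    also have "\<dots> = (A + B)\<^sup>2"
      using A B by (simp add: power2_eq_square)
    finally have "sqrt (I (\<lambda>x. f x + g x)) \<le> A + B"
      using A B by (intro real_le_lsqrt) auto
    then show ?thesis by (simp add: A_def B_def)
  qed
  then have "sqrt (I (\<lambda>x. f x + g x)) \<le> sqrt (I f) + sqrt (I g)"
    by (rule field_le_epsilon)
  then show ?thesis
    using f g L2_add[OF f g] I_nonneg
    by (simp add: L2_norm_def I_def ennreal_leI flip: ennreal_plus)
qed (auto simp: L2_norm_def)

lemma L2_norm_cmult_le: "L2_norm (\<lambda>x. a * f x) \<le> ennreal \<bar>a\<bar> * L2_norm f"
proof (cases "f \<in> L2")
  case True
  note [measurable] = L2D(1)[OF True]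
  have "(\<lambda>x. a * f x) \<in> L2"
    by (intro L2I) (simp_all add: power_mult_distrib L2D(2)[OF True])
  with True show ?thesis
    by (simp add: L2_norm_def power_mult_distrib real_sqrt_mult ennreal_mult)
next
  case False
  then show ?thesis
    \<comment> \<open>For \<open>a = 0\<close> the left side is the norm of the zero function, and 0
      times infinity is 0 in \<open>ennreal\<close>; for any other \<open>a\<close> the right side
      is infinite.\<close>
    by (cases "a = 0") (auto simp: L2_norm_def L2_def ennreal_mult_top)
qed

lemma L2_norm_diff_le: "L2_norm (\<lambda>x. f x - g x) \<le> L2_norm f + L2_norm g"
proof -
  have "L2_norm (\<lambda>x. f x + (- 1) * g x) \<le> L2_norm f + L2_norm (\<lambda>x. (- 1) * g x)"
    by (rule L2_norm_triangle)
  also have "\<dots> \<le> L2_norm f + L2_norm g"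
    using L2_norm_cmult_le[of "- 1" g] by (intro add_left_mono) simp
  finally show ?thesis by simp
qed

lemma L2_norm_sum_le:
  "L2_norm (\<lambda>x. \<Sum>i\<in>I. f i x) \<le> (\<Sum>i\<in>I. L2_norm (f i))"
proof (induction I rule: infinite_finite_induct)
  case (insert i I)
  then have "L2_norm (\<lambda>x. \<Sum>j\<in>insert i I. f j x) \<le> L2_norm (f i) + L2_norm (\<lambda>x. \<Sum>j\<in>I. f j x)"
    by (simp add: L2_norm_triangle)
  also have "\<dots> \<le> (\<Sum>j\<in>insert i I. L2_norm (f j))"
    using insert by (simp add: add_left_mono)
  finally show ?case .
\<comment> \<open>The empty and the infinite index set remain; both sums are then 0, a sum over an
  infinite set being 0 by convention.\<close>
qed (simp_all add: L2_norm_def L2_def)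

section \<open>Lebesgue measure and the L2 norm under affine maps of constant ratio\<close>

lemma lebesgue_affine:
  fixes t :: "'a::euclidean_space"
  assumes "r \<noteq> 0"
  shows "(\<lambda>x. r *\<^sub>R x + t) \<in> lebesgue \<rightarrow>\<^sub>M lebesgue"
    and "lebesgue = density (distr lebesgue lebesgue (\<lambda>x. r *\<^sub>R x + t)) (\<lambda>_. ennreal (\<bar>r\<bar> ^ DIM('a)))"
proof -
  \<comment> \<open>A coordinatewise affine map whose factors all equal \<open>r\<close> is a
    homothety followed by a translation; the product of the factors becomes a power of
    \<open>r\<close>.\<close>
  have eq: "(\<lambda>x. t + (\<Sum>j\<in>Basis. (r * (x \<bullet> j)) *\<^sub>R j)) = (\<lambda>x::'a. r *\<^sub>R x + t)"
    unfolding scaleR_scaleR[symmetric] scaleR_sum_right[symmetric]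
    by (simp add: euclidean_representation add.commute)
  show "(\<lambda>x. r *\<^sub>R x + t) \<in> lebesgue \<rightarrow>\<^sub>M lebesgue"
    using lebesgue_affine_measurable[of "\<lambda>_. r" t] assms by (simp add: eq)
  show "lebesgue = density (distr lebesgue lebesgue (\<lambda>x. r *\<^sub>R x + t)) (\<lambda>_. ennreal (\<bar>r\<bar> ^ DIM('a)))"
    using lebesgue_affine_euclidean[of "\<lambda>_. r" t] assms by (simp add: eq)
qed

text \<open>Lebesgue measure is the constant \<open>\<bar>r\<bar> ^ DIM('a)\<close> times its own
  image under the map. Integrability and the integral of \<open>g\<close> pass to the image measure
  up to this nonzero constant, and from there to \<open>g\<close> composed with the map.\<close>

lemma
  fixes g :: "'a::euclidean_space \<Rightarrow> real"
  assumes r: "r \<noteq> 0" and g: "integrable lebesgue g"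
  shows lebesgue_integrable_affine: "integrable lebesgue (\<lambda>x. g (r *\<^sub>R x + t))"
    and lebesgue_integral_affine:
      "(\<integral>x. g (r *\<^sub>R x + t) \<partial>lebesgue) = (\<integral>x. g x \<partial>lebesgue) / \<bar>r\<bar> ^ DIM('a)"
proof -
  let ?T = "\<lambda>x::'a. r *\<^sub>R x + t" and ?c = "\<bar>r\<bar> ^ DIM('a)"
  note T = lebesgue_affine(1)[OF r, of t] and eq = lebesgue_affine(2)[OF r, of t]
  have gm[measurable]: "g \<in> borel_measurable lebesgue"
    using g by (rule borel_measurable_integrable)
  have gm': "g \<in> borel_measurable (distr lebesgue lebesgue ?T)"
    using gm by simp
  have "integrable (density (distr lebesgue lebesgue ?T) (\<lambda>_. ennreal ?c)) g"
    using g eq by simp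
  then have "integrable (distr lebesgue lebesgue ?T) (\<lambda>x. ?c *\<^sub>R g x)"
    using gm' by (subst (asm) integrable_density) simp_all
  then have "integrable (distr lebesgue lebesgue ?T) g"
    using r by simp
  then show "integrable lebesgue (\<lambda>x. g (?T x))"
    using T by (rule integrable_distr[rotated])
  have "(\<integral>x. g x \<partial>lebesgue) = (\<integral>x. g x \<partial>density (distr lebesgue lebesgue ?T) (\<lambda>_. ennreal ?c))"
    using eq by simp
  also have "\<dots> = ?c * (\<integral>x. g x \<partial>distr lebesgue lebesgue ?T)"
    using gm' by (subst integral_density) simp_all
  also have "\<dots> = ?c * (\<integral>x. g (?T x) \<partial>lebesgue)"
    using T by (subst integral_distr) simp_all
  finally show "(\<integral>x. g (?T x) \<partial>lebesgue) = (\<integral>x. g x \<partial>lebesgue) / ?c"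
    using r by simp
qed

text \<open>The substitution divides the integral of the square by \<open>r ^ CARD('n)\<close>; the
  factor here is the square root of that Jacobian.\<close>

lemma L2_norm_affine:
  fixes f :: "real^'n \<Rightarrow> real"
  assumes r: "r > 0" and f: "f \<in> L2"
  shows "L2_norm (\<lambda>x. f (r *\<^sub>R x + t)) = ennreal (r powr (- CARD('n) / 2)) * L2_norm f"
proof -
  have "(\<lambda>x. f (r *\<^sub>R x + t)) \<in> borel_measurable lebesgue"
    using measurable_compose[OF lebesgue_affine(1) L2D(1)[OF f]] r by simp
  then have "(\<lambda>x. f (r *\<^sub>R x + t)) \<in> L2"
    using r by (intro L2I lebesgue_integrable_affine L2D(2)[OF f]) auto
  moreover have "sqrt (\<integral>x. (f (r *\<^sub>R x + t))\<^sup>2 \<partial>lebesgue)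
      = r powr (- CARD('n) / 2) * sqrt (\<integral>x. (f x)\<^sup>2 \<partial>lebesgue)"
  proof -
    have "sqrt (r ^ CARD('n)) = r powr (CARD('n) / 2)"
      using r by (simp add: powr_half_sqrt[symmetric] powr_realpow[symmetric] powr_powr)
    moreover have "(\<integral>x. (f (r *\<^sub>R x + t))\<^sup>2 \<partial>lebesgue)
        = (\<integral>x. (f x)\<^sup>2 \<partial>lebesgue) / r ^ CARD('n)"
      using r lebesgue_integral_affine[of r "\<lambda>x. (f x)\<^sup>2" t] L2D(2)[OF f] by simp
    ultimately show ?thesis
      by (simp add: real_sqrt_divide powr_minus_divide del: real_sqrt_power)
  qed
  ultimately show ?thesis
    using f by (simp add: L2_norm_def ennreal_mult)
qed

section \<open>Norm bounds for the dilated profiles, uniform in scale and position\<close>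

lemma S_eq_affine:
  fixes b :: "real^'n"
  shows "S \<tau> k x b = 2 powr k *
    \<tau> ((2 powr (k / CARD('n))) *\<^sub>R x + - ((2 powr (k / CARD('n))) *\<^sub>R b))"
  by (simp add: S_def scaleR_diff_right)

text \<open>The amplitude \<open>2 powr k\<close> meets the factor \<open>2 powr (- k / 2)\<close>
  that the dilation by \<open>2 powr (k / CARD('n))\<close> produces in the norm, whatever the
  dimension.\<close>

lemma L2_norm_S_le:
  fixes \<tau> :: "real^'n \<Rightarrow> real"
  assumes "\<tau> \<in> L2"
  shows "L2_norm (\<lambda>x. S \<tau> k x b) \<le> ennreal (2 powr (k / 2)) * L2_norm \<tau>"
proof -
  define r where "r = (2::real) powr (k / CARD('n))"
  have r: "r > 0" by (simp add: r_def)
  have "L2_norm (\<lambda>x. S \<tau> k x b)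
      \<le> ennreal \<bar>2 powr k\<bar> * L2_norm (\<lambda>x. \<tau> (r *\<^sub>R x + - (r *\<^sub>R b)))"
    unfolding S_eq_affine r_def[symmetric] by (rule L2_norm_cmult_le)
  also have "\<dots> = ennreal (2 powr k * r powr (- CARD('n) / 2)) * L2_norm \<tau>"
    by (simp only: L2_norm_affine[OF r assms]) (simp add: ennreal_mult mult.assoc)
  also have "2 powr k * r powr (- CARD('n) / 2) = 2 powr (k / 2)"
    by (simp add: r_def powr_powr powr_add[symmetric])
  finally show ?thesis .
qed

text \<open>The weight \<open>2 powr (- k / 2)\<close> cancels the growth of the part at scale
  \<open>k\<close> and leaves \<open>1 / sqrt 2\<close> for the part at scale \<open>k - 1\<close>.
  The resulting constant is the one in \<open>L2_dist\<close>, and it depends on neither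
  \<open>k\<close> nor \<open>b\<close>.\<close>

lemma L2_norm_psi_le:
  fixes \<tau> :: "real^'n \<Rightarrow> real"
  assumes "\<tau> \<in> L2"
  shows "L2_norm (\<psi> \<tau> k b) \<le> ennreal (1 + 1 / sqrt 2) * L2_norm \<tau>"
proof -
  have "L2_norm (\<psi> \<tau> k b) = L2_norm (\<lambda>x. 2 powr (- k / 2) * (S \<tau> k x b - S \<tau> (k - 1) x b))"
    by (rule arg_cong[where f = L2_norm]) (simp add: fun_eq_iff \<psi>_def)
  also have "\<dots> \<le> ennreal \<bar>2 powr (- k / 2)\<bar> * L2_norm (\<lambda>x. S \<tau> k x b - S \<tau> (k - 1) x b)"
    by (rule L2_norm_cmult_le)
  also have "\<dots> \<le> ennreal \<bar>2 powr (- k / 2)\<bar> *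
      (ennreal (2 powr (k / 2)) * L2_norm \<tau> + ennreal (2 powr ((k - 1) / 2)) * L2_norm \<tau>)"
    using L2_norm_S_le[OF assms, of k b] L2_norm_S_le[OF assms, of "k - 1" b]
    by (intro mult_left_mono order.trans[OF L2_norm_diff_le] add_mono) auto
  also have "\<dots> = ennreal (2 powr (- k / 2) * (2 powr (k / 2) + 2 powr ((k - 1) / 2))) * L2_norm \<tau>"
    by (simp add: ennreal_mult distrib_right mult.assoc)
  also have "2 powr (- k / 2) * (2 powr (k / 2) + 2 powr ((k - 1) / 2)) = 1 + 1 / sqrt 2"
  proof -
    have "2 powr ((k - 1) / 2) = 2 powr (k / 2 - 1 / 2)"
      by (simp add: diff_divide_distrib)
    also have "\<dots> = 2 powr (k / 2) * (1 / sqrt 2)"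
      by (simp only: powr_diff) (simp add: powr_half_sqrt)
    finally have "2 powr (- k / 2) * (2 powr (k / 2) + 2 powr ((k - 1) / 2))
        = (2 powr (- k / 2) * 2 powr (k / 2)) * (1 + 1 / sqrt 2)"
      by (simp only: distrib_left mult_1_right mult.assoc)
    also have "2 powr (- k / 2) * 2 powr (k / 2) = (1::real)"
      by (simp flip: powr_add)
    finally show ?thesis by simp
  qed
  finally show ?thesis .
qed

section \<open>Linearity in the profile and expansion into dilates and translates of one
  function\<close>

lemma psi_diff: "\<psi> (\<lambda>x. \<tau> x - \<rho> x) k b x = \<psi> \<tau> k b x - \<psi> \<rho> k b x"
  by (simp add: \<psi>_def S_def algebra_simps)

text \<open>The index \<open>j\<close> selects the scale \<open>k\<close> or \<open>k - 1\<close>,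
  with sign plus or minus; these two scales are the source of the factor 2 in the number of terms.
  The shift \<open>v m\<close> is applied after the dilation and so is not rescaled, unlike
  \<open>b\<close>.\<close>

lemma psi_sum_translates:
  fixes \<phi> :: "real^'n \<Rightarrow> real"
  shows "\<psi> (\<lambda>x. \<Sum>m\<in>A. w m * \<phi> (x - v m)) k b x =
    (\<Sum>j\<in>{0, 1::int}. \<Sum>m\<in>A. 2 powr (- k / 2) * (if j = 0 then 1 else - 1) * 2 powr (k - j) * w m *
       \<phi> ((2 powr ((k - j) / CARD('n))) *\<^sub>R x + - ((2 powr ((k - j) / CARD('n))) *\<^sub>R b + v m)))"
  by (simp add: \<psi>_def S_def sum_distrib_left right_diff_distrib scaleR_diff_right mult.assoc
      sum_negf add_diff_eq)

(* The list of K terms is padded with zero coefficients. *)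
lemma sum_affine_reindex:
  fixes \<phi> :: "'a::real_vector \<Rightarrow> real"
  assumes I: "finite I" "card I \<le> K"
  obtains \<alpha> \<gamma> :: "nat \<Rightarrow> real" and \<theta> :: "nat \<Rightarrow> 'a"
    where "\<And>x. (\<Sum>i\<in>I. a i * \<phi> (g i *\<^sub>R x + t i)) = (\<Sum>n=1..K. \<alpha> n * \<phi> (\<gamma> n *\<^sub>R x + \<theta> n))"
proof -
  obtain h where h: "bij_betw h {1..card I} I"
    using ex_bij_betw_nat_finite_1[OF I(1)] by blast
  define \<alpha> where "\<alpha> n = (if n \<le> card I then a (h n) else 0)" for n
  have "(\<Sum>i\<in>I. a i * \<phi> (g i *\<^sub>R x + t i)) = (\<Sum>n=1..K. \<alpha> n * \<phi> (g (h n) *\<^sub>R x + t (h n)))" for x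
  proof -
    have "(\<Sum>i\<in>I. a i * \<phi> (g i *\<^sub>R x + t i))
        = (\<Sum>n=1..card I. a (h n) * \<phi> (g (h n) *\<^sub>R x + t (h n)))"
      by (rule sum.reindex_bij_betw[OF h, symmetric])
    also have "\<dots> = (\<Sum>n=1..K. \<alpha> n * \<phi> (g (h n) *\<^sub>R x + t (h n)))"
      using I(2) by (intro sum.mono_neutral_cong_left) (auto simp: \<alpha>_def)
    finally show ?thesis .
  qed
  then show ?thesis by (rule that[of \<alpha> "\<lambda>n. g (h n)" "\<lambda>n. t (h n)"])
qed

text \<open>Each pair in \<open>F\<close> contributes one term for each of two scales and
  \<open>M\<close> translates, so the terms are indexed by a product set of size at most
  \<open>2 * N * M\<close>.\<close>

lemma sum_psi_translates_affine:
  fixes \<phi> :: "real^'n \<Rightarrow> real" and a :: "int \<Rightarrow> real^'n \<Rightarrow> real"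
  assumes F: "finite F" "card F \<le> N"
  obtains \<alpha> \<gamma> :: "nat \<Rightarrow> real" and \<theta> :: "nat \<Rightarrow> real^'n"
    where "\<And>x. (\<Sum>(k, b)\<in>F. a k b * \<psi> (\<lambda>x. \<Sum>m=1..M. w m * \<phi> (x - v m)) k b x)
      = (\<Sum>n=1..2*N*M. \<alpha> n * \<phi> (\<gamma> n *\<^sub>R x + \<theta> n))"
proof -
  \<comment> \<open>\<open>A\<close>, \<open>G\<close> and \<open>T\<close> are the coefficient,
    dilation and shift of the term with index \<open>((k, b), j, m)\<close>, as given by
    \<open>psi_sum_translates\<close>.\<close>
  define A where "A = (\<lambda>((k, b), j, m). a k b *
    (2 powr (- real_of_int k / 2) * (if j = (0::int) then 1 else - 1) * 2 powr (k - j) * w m))"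
  define G where "G = (\<lambda>((k, b :: real^'n), j :: int, m :: nat). (2::real) powr ((k - j) / CARD('n)))"
  define T where "T = (\<lambda>((k, b), j, m). - ((2 powr (real_of_int (k - j) / CARD('n))) *\<^sub>R b + v m))"
  let ?I = "F \<times> {0, 1::int} \<times> {1..M}"
  have "card ?I = card F * 2 * M"
    by (simp add: card_cartesian_product)
  also have "\<dots> \<le> 2 * N * M"
    using F(2) by simp
  finally obtain \<alpha> \<gamma> \<theta> where eq:
    "\<And>x. (\<Sum>i\<in>?I. A i * \<phi> (G i *\<^sub>R x + T i)) = (\<Sum>n=1..2*N*M. \<alpha> n * \<phi> (\<gamma> n *\<^sub>R x + \<theta> n))"
    using sum_affine_reindex[of ?I "2 * N * M" A \<phi> G T] F(1) by auto
  have "(\<Sum>(k, b)\<in>F. a k b * \<psi> (\<lambda>x. \<Sum>m=1..M. w m * \<phi> (x - v m)) k b x)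
      = (\<Sum>i\<in>?I. A i * \<phi> (G i *\<^sub>R x + T i))" for x
    unfolding sum.cartesian_product[symmetric] sum.cartesian_product'
    by (intro sum.cong refl)
      (auto simp: psi_sum_translates sum_distrib_left distrib_left A_def G_def T_def mult.assoc split: prod.splits
        simp flip: sum.cartesian_product)
  with eq show ?thesis
    by (intro that[of \<alpha> \<gamma> \<theta>]) simp
qed

section \<open>Replacement of the profile in an approximation with at most \<open>N\<close>
  terms\<close>

theorem theorem4p3:
  fixes \<sigma> \<sigma>0 f fN :: "real^'n \<Rightarrow> real"
    and c \<epsilon>0 C' \<epsilon> :: real
    and M N :: nat
    and cm :: "nat \<Rightarrow> real" and bm :: "nat \<Rightarrow> real^'n"
    and ckb \<chi>N :: "int \<Rightarrow> real^'n \<Rightarrow> real"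
  assumes "c > 0" and "0 < \<epsilon>0" and "\<epsilon>0 \<le> 1 / CARD('n)"
    and "twice_differentiable \<sigma>"
    and "(\<integral>x. \<sigma> x \<partial>lebesgue) = 1"
    and "\<forall>x. \<sigma> (- x) = \<sigma> x"
    and "C' > 0"
    and "\<forall>x. \<bar>\<sigma> x\<bar> \<le> C' / (inverse c + norm x ^ CARD('n)) powr (1 + \<epsilon>0)"
    and "\<forall>x. norm (gradient \<sigma> x)
               \<le> C' / (inverse c + norm x ^ CARD('n)) powr (1 + \<epsilon>0 + 1 / CARD('n))"
    and "\<forall>x. norm (hessian \<sigma> x)
               \<le> C' / (inverse c + norm x ^ CARD('n)) powr (1 + \<epsilon>0 + 2 / CARD('n))"
    and "\<sigma>0 \<in> L2"
    and "\<epsilon> > 0"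
    and "L2_dist \<sigma> (\<lambda>x. \<Sum>m=1..M. cm m * \<sigma>0 (x - bm m)) < ennreal \<epsilon>"
    and "f \<in> L1 \<sigma>"
    and "\<forall>(k, b)\<in>\<Lambda>. \<chi>N k b \<in> {0, 1}"
    and "finite {(k, b)\<in>\<Lambda>. \<chi>N k b = 1}" and "card {(k, b)\<in>\<Lambda>. \<chi>N k b = 1} \<le> N"
    and "fN = (\<lambda>x. \<Sum>\<^sub>\<infinity>(k, b)\<in>\<Lambda>. \<chi>N k b * ckb k b * \<psi> \<sigma> k b x)"
    and "L2_norm (\<lambda>x. f x - fN x) \<le> L1_norm \<sigma> f * ennreal ((real N + 1) powr (- 1 / 2))"
  shows "\<exists>(\<alpha> :: nat \<Rightarrow> real) (\<gamma> :: nat \<Rightarrow> real) (\<theta> :: nat \<Rightarrow> real^'n).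
           L2_norm (\<lambda>x. f x - (\<Sum>n=1..2*N*M. \<alpha> n * \<sigma>0 (\<gamma> n *\<^sub>R x + \<theta> n)))
             \<le> L1_norm \<sigma> f * ennreal ((real N + 1) powr (- 1 / 2))
               + ennreal (\<epsilon> * (\<Sum>\<^sub>\<infinity>(k, b)\<in>\<Lambda>. \<chi>N k b * \<bar>ckb k b\<bar>))"
proof -
  note dist = assms(13) and \<chi>01 = assms(15)
    and fN = assms(18) and approx = assms(19)
  define \<sigma>1 where "\<sigma>1 = (\<lambda>x. \<Sum>m=1..M. cm m * \<sigma>0 (x - bm m))"
  define \<tau> where "\<tau> = (\<lambda>x. \<sigma> x - \<sigma>1 x)"
  define F where "F = {(k, b)\<in>\<Lambda>. \<chi>N k b = 1}"
  have F: "finite F" "card F \<le> N"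
    using assms(16,17) by (simp_all add: F_def)
  \<comment> \<open>On \<open>\<Lambda>\<close> the factor \<open>\<chi>N\<close> is 1 on
    \<open>F\<close> and 0 elsewhere, so the infinite sum has only finitely many nonzero terms. This
    serves both for \<open>fN\<close> and for the sum of coefficients in the bound.\<close>
  have infsum_F: "(\<Sum>\<^sub>\<infinity>(k, b)\<in>\<Lambda>. \<chi>N k b * h k b) = (\<Sum>(k, b)\<in>F. h k b)"
    for h :: "int \<Rightarrow> real^'n \<Rightarrow> real"
  proof -
    have "(\<Sum>\<^sub>\<infinity>(k, b)\<in>\<Lambda>. \<chi>N k b * h k b) = (\<Sum>\<^sub>\<infinity>(k, b)\<in>F. h k b)"
      using \<chi>01 by (intro infsum_cong_neutral) (auto simp: F_def)
    then show ?thesis using F by simp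
  qed
  have fN_eq: "fN x = (\<Sum>(k, b)\<in>F. ckb k b * \<psi> \<sigma> k b x)" for x
    using infsum_F[of "\<lambda>k b. ckb k b * \<psi> \<sigma> k b x"] by (simp add: fN mult.assoc)
  obtain \<alpha> \<gamma> :: "nat \<Rightarrow> real" and \<theta> :: "nat \<Rightarrow> real^'n" where \<Psi>:
    "\<And>x. (\<Sum>(k, b)\<in>F. ckb k b * \<psi> (\<lambda>x. \<Sum>m=1..M. cm m * \<sigma>0 (x - bm m)) k b x)
      = (\<Sum>n=1..2*N*M. \<alpha> n * \<sigma>0 (\<gamma> n *\<^sub>R x + \<theta> n))"
    by (rule sum_psi_translates_affine[OF F]) (rule that)
  note \<Psi> = \<Psi>[folded \<sigma>1_def]
  have dist': "ennreal (1 + 1 / sqrt 2) * L2_norm \<tau> < ennreal \<epsilon>"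
    using dist by (simp add: L2_dist_def \<tau>_def \<sigma>1_def)
  \<comment> \<open>Outside \<open>L2\<close> the norm of \<open>\<tau>\<close> would be infinite,
    and so would its product with this positive constant, contradicting the bound by
    \<epsilon>.\<close>
  have "0 < 1 + 1 / sqrt 2"
    by (simp add: add_pos_pos)
  then have \<tau>: "\<tau> \<in> L2"
    using dist' unfolding L2_norm_def by (auto simp: ennreal_mult_top split: if_splits)
  have \<psi>\<tau>: "L2_norm (\<psi> \<tau> k b) \<le> ennreal \<epsilon>" for k b
    using L2_norm_psi_le[OF \<tau>] dist' by (rule order.trans[OF _ less_imp_le])
  have "L2_norm (\<lambda>x. f x - (\<Sum>n=1..2*N*M. \<alpha> n * \<sigma>0 (\<gamma> n *\<^sub>R x + \<theta> n)))
      = L2_norm (\<lambda>x. (f x - fN x) + (\<Sum>(k, b)\<in>F. ckb k b * \<psi> \<tau> k b x))"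
    \<comment> \<open>By \<open>psi_diff\<close>, \<open>fN\<close> minus the new combination is the
      same expansion over \<open>F\<close> with the error \<open>\<tau>\<close> as profile; adding
      and subtracting \<open>fN\<close> gives the splitting.\<close>
    unfolding fN_eq \<Psi>[symmetric] \<tau>_def
    by (simp add: psi_diff right_diff_distrib sum_subtractf case_prod_unfold)
  also have "\<dots> \<le> L2_norm (\<lambda>x. f x - fN x) + L2_norm (\<lambda>x. \<Sum>(k, b)\<in>F. ckb k b * \<psi> \<tau> k b x)"
    by (rule L2_norm_triangle)
  also have "L2_norm (\<lambda>x. \<Sum>(k, b)\<in>F. ckb k b * \<psi> \<tau> k b x)
      \<le> (\<Sum>(k, b)\<in>F. L2_norm (\<lambda>x. ckb k b * \<psi> \<tau> k b x))"
    using L2_norm_sum_le[of "\<lambda>(k, b) x. ckb k b * \<psi> \<tau> k b x" F] by (simp add: case_prod_unfold)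
  also have "\<dots> \<le> (\<Sum>(k, b)\<in>F. ennreal \<bar>ckb k b\<bar> * ennreal \<epsilon>)"
    using \<psi>\<tau> by (intro sum_mono) (auto intro!: order.trans[OF L2_norm_cmult_le] mult_left_mono)
  also have "\<dots> = ennreal (\<epsilon> * (\<Sum>\<^sub>\<infinity>(k, b)\<in>\<Lambda>. \<chi>N k b * \<bar>ckb k b\<bar>))"
    \<comment> \<open>Since \<epsilon> and the absolute values are nonnegative, the finite sum of
      \<open>ennreal\<close> products is the image of a real sum.\<close>
    using \<open>\<epsilon> > 0\<close> unfolding infsum_F
    by (simp add: sum_distrib_left case_prod_unfold mult.commute flip: ennreal_mult sum_ennreal)
  finally show ?thesis
    using approx by (intro exI[of _ \<alpha>] exI[of _ \<gamma>] exI[of _ \<theta>])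
      (auto elim!: order.trans intro: add_right_mono)
qed

end
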